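(* For any weighted $k$-majority tournament $T$, $k/2 \leq \gamma_w(T) \leq 2k-1$.
   Context: Let $k \ge 1$ be an integer. A linear order on a finite set $V=\{v_1,\ldots,v_n\}$ is an ordering of all the elements of $V$ in a strictly increasing list. A $k$-majority tournament $T$ on the finite vertex set $V(T)=V=\{v_1,\ldots,v_n\}$ is defined by a list of $2k-1$ (not necessarily distinct) linear orders on $V$: for $u,v\in V$ there is a directed edge $u\to v$ in $T$ if and only if $u>v$ in at least $k$ of the $2k-1$ orders. A weighted $k$-majority tournament is a $k$-majority tournament in which each edge $u\to v$ has weight $w(u\to v)$ equal to the number of the $2k-1$ linear orders in which $u>v$ (so $k\le w(u\to v)\le 2k-1$). A dominating set of $T$ is a set $D\subseteq V(T)$ such that for each vertex $v\notin D$ there exists a vertex $u\in D$ with $u\to v$. For a dominating set $D$ of $T$ and a vertex $v$ of $T$, the average inweight of $v$ with respect to $D$ is $$w_a(v,D)=\frac{1}{|D|}\sum_{u\in D,\ u\to v\in E(T)} w(u\to v),$$ where $E(T)$ is the set of directed edges of $T$. The weight (also called the approval gap) of $D$ on $T$ is $W(T,D)=\min_{v\notin D} w_a(v,D)$ if $D\neq V(T)$, and $W(T,D)=0$ if $D=V(T)$. The maximum approval gap of $T$ is $\gamma_w(T)=\max_D W(T,D)$, where the maximum is taken over all dominating sets $D$ of $T$.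
   Formalization: The lower bound k/2 ≤ γ_w(T) is stated only for tournaments with at least two vertices; with at most one vertex the only dominating set is V(T), so γ_w(T) = 0 < k/2 and the bound fails. *)

theory Defs
  imports Complex_Main "Graph_Theory.Pair_Digraph"
begin

record 'a weighted_digraph = "'a pair_pre_digraph" +
  weight :: "'a \<times> 'a \<Rightarrow> nat"

text \<open>
  A linear order is a reflexive relation \<^term>\<open>R\<close>, with \<^term>\<open>(x, y) \<in> R\<close> read as \<open>x \<le> y\<close>;
  so \<open>u > v\<close> in \<^term>\<open>R\<close> means \<^term>\<open>(v, u) \<in> R \<and> u \<noteq> v\<close>. The count ranges over list positions,
  because the same order may occur several times.
\<close>

definition votes :: "'a rel list \<Rightarrow> 'a \<Rightarrow> 'a \<Rightarrow> nat" where
  "votes Rs u v = card {i. i < length Rs \<and> (v, u) \<in> Rs ! i \<and> u \<noteq> v}"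

definition weighted_majority_tournament :: "nat \<Rightarrow> 'a weighted_digraph \<Rightarrow> bool" where
  "weighted_majority_tournament k T \<longleftrightarrow>
     k \<ge> 1 \<and> finite (pverts T) \<and>
     (\<exists>Rs. length Rs = 2 * k - 1 \<and>
        (\<forall>R \<in> set Rs. linear_order_on (pverts T) R) \<and>
        parcs T = {(u, v). u \<in> pverts T \<and> v \<in> pverts T \<and> k \<le> votes Rs u v} \<and>
        (\<forall>(u, v) \<in> parcs T. weight T (u, v) = votes Rs u v))"

definition dominating_set :: "'a weighted_digraph \<Rightarrow> 'a set \<Rightarrow> bool" where
  "dominating_set T D \<longleftrightarrow>
     D \<subseteq> pverts T \<and> (\<forall>v \<in> pverts T - D. \<exists>u \<in> D. (u, v) \<in> parcs T)"

definition avg_inweight :: "'a weighted_digraph \<Rightarrow> 'a \<Rightarrow> 'a set \<Rightarrow> real" where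
  "avg_inweight T v D =
     1 / real (card D) * (\<Sum>u \<in> {u \<in> D. (u, v) \<in> parcs T}. real (weight T (u, v)))"

definition approval_gap :: "'a weighted_digraph \<Rightarrow> 'a set \<Rightarrow> real" where
  "approval_gap T D =
     (if D = pverts T then 0 else Min ((\<lambda>v. avg_inweight T v D) ` (pverts T - D)))"

definition max_approval_gap :: "'a weighted_digraph \<Rightarrow> real" where
  "max_approval_gap T = Max (approval_gap T ` {D. dominating_set T D})"

end

theory Submission
  imports Defs
begin

text \<open>
  In any tournament on at least two vertices the indegrees and the outdegrees have the same sum,
  so some vertex \<open>v\<close> beats at most as many vertices as beat it (\<open>exists_indegree_ge_outdegree\<close>).
  Every other vertex is joined to \<open>v\<close>, so at least half of the other vertices beat \<open>v\<close>.
  Let \<open>D\<close> consist of all vertices except \<open>v\<close>. This set dominates, \<open>v\<close> is the only vertex outside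
  it, and at least half of \<open>D\<close> sends \<open>v\<close> an edge of weight at least \<open>k\<close>; hence the approval gap
  of \<open>D\<close> is at least \<open>k/2\<close> (\<open>exists_dominating_set_gap_ge_half\<close>).

  The upper bound holds for each dominating set separately: no edge weighs more than the number
  \<open>2k - 1\<close> of orders, and an average inweight divides a sum of at most \<open>|D|\<close> weights by \<open>|D|\<close>.
\<close>

lemma votes_le_length: "votes Rs u v \<le> length Rs"
proof -
  have "votes Rs u v \<le> card {i. i < length Rs}"
    unfolding votes_def by (rule card_mono) auto
  then show ?thesis by simp
qed

text \<open>
  Each order is total, so it contributes a vote to one side or the other. With \<open>2k - 1\<close> orders,
  one of the two sides therefore collects at least \<open>k\<close> votes.
\<close>

lemma length_le_votes_add:
  assumes lin: "\<forall>R \<in> set Rs. linear_order_on V R"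
    and "u \<in> V" "v \<in> V" "u \<noteq> v"
  shows "length Rs \<le> votes Rs u v + votes Rs v u"
proof -
  let ?A = "\<lambda>u v. {i. i < length Rs \<and> (v, u) \<in> Rs ! i \<and> u \<noteq> v}"
  have "(v, u) \<in> Rs ! i \<or> (u, v) \<in> Rs ! i" if "i < length Rs" for i
  proof -
    have "total_on V (Rs ! i)"
      using lin that by (auto simp: linear_order_on_def)
    then show ?thesis
      using assms(2-4) by (auto simp: total_on_def)
  qed
  then have "{..<length Rs} \<subseteq> ?A u v \<union> ?A v u"
    using \<open>u \<noteq> v\<close> by auto
  then have "card {..<length Rs} \<le> card (?A u v \<union> ?A v u)"
    by (intro card_mono) auto
  also have "\<dots> \<le> card (?A u v) + card (?A v u)"
    by (rule card_Un_le)
  finally show ?thesis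
    by (simp add: votes_def)
qed

lemma majority_tournament_arcs_total:
  assumes "weighted_majority_tournament k T"
    and "u \<in> pverts T" "v \<in> pverts T" "u \<noteq> v"
  shows "(u, v) \<in> parcs T \<or> (v, u) \<in> parcs T"
proof -
  obtain Rs where Rs: "length Rs = 2 * k - 1" "\<forall>R \<in> set Rs. linear_order_on (pverts T) R"
    and arcs: "parcs T = {(u, v). u \<in> pverts T \<and> v \<in> pverts T \<and> k \<le> votes Rs u v}"
    using assms(1) unfolding weighted_majority_tournament_def by blast
  have "2 * k - 1 \<le> votes Rs u v + votes Rs v u"
    using length_le_votes_add[OF Rs(2) assms(2-4)] Rs(1) by simp
  then have "k \<le> votes Rs u v \<or> k \<le> votes Rs v u"
    by linarith
  then show ?thesis
    using assms(2,3) by (simp add: arcs)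
qed

lemma majority_tournament_weight_bounds:
  assumes "weighted_majority_tournament k T" and "(u, v) \<in> parcs T"
  shows "k \<le> weight T (u, v)" and "weight T (u, v) \<le> 2 * k - 1"
proof -
  obtain Rs where "length Rs = 2 * k - 1"
    and "parcs T = {(u, v). u \<in> pverts T \<and> v \<in> pverts T \<and> k \<le> votes Rs u v}"
    and "\<forall>(u, v) \<in> parcs T. weight T (u, v) = votes Rs u v"
    using assms(1) unfolding weighted_majority_tournament_def by blast
  then show "k \<le> weight T (u, v)" and "weight T (u, v) \<le> 2 * k - 1"
    using assms(2) votes_le_length[of Rs u v] by auto
qed

text \<open>
  Otherwise every outdegree would exceed the indegree at the same vertex, although both degrees
  sum to the number of pairs of the relation.
\<close>

lemma exists_indegree_ge_outdegree:
  assumes "finite V" "V \<noteq> {}"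
  shows "\<exists>v \<in> V. card {u \<in> V. P v u} \<le> card {u \<in> V. P u v}"
proof (rule ccontr)
  assume "\<not> ?thesis"
  then have "(\<Sum>v\<in>V. card {u \<in> V. P u v}) < (\<Sum>v\<in>V. card {u \<in> V. P v u})"
    using assms by (intro sum_strict_mono) auto
  moreover have "(\<Sum>v\<in>V. card {u \<in> V. P u v}) = (\<Sum>v\<in>V. card {u \<in> V. P v u})"
    using sum.swap_restrict[OF assms(1) assms(1), of "\<lambda>_ _. 1::nat" P] by simp
  ultimately show False by simp
qed

lemma exists_dominating_set_gap_ge_half:
  assumes T: "weighted_majority_tournament k T" and n: "card (pverts T) \<ge> 2"
  shows "\<exists>D. dominating_set T D \<and> real k / 2 \<le> approval_gap T D"
proof -
  have fin: "finite (pverts T)"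
    using T by (simp add: weighted_majority_tournament_def)
  have "pverts T \<noteq> {}"
    using n by auto
  then obtain v where v: "v \<in> pverts T"
    and deg: "card {u \<in> pverts T. (v, u) \<in> parcs T} \<le> card {u \<in> pverts T. (u, v) \<in> parcs T}"
    using exists_indegree_ge_outdegree[OF fin, of "\<lambda>u v. (u, v) \<in> parcs T"] by blast
  have no_loop: "(v, v) \<notin> parcs T"
    using T by (auto simp: weighted_majority_tournament_def votes_def)
  define D where "D = pverts T - {v}"
  define I where "I = {u \<in> D. (u, v) \<in> parcs T}"
  define S where "S = {u \<in> D. (v, u) \<in> parcs T}"
  have "{u \<in> pverts T. (v, u) \<in> parcs T} = S" "{u \<in> pverts T. (u, v) \<in> parcs T} = I"
    using no_loop by (auto simp: D_def I_def S_def)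
  then have "card S \<le> card I"
    using deg by simp
  moreover have "D \<subseteq> I \<union> S"
    using majority_tournament_arcs_total[OF T _ v] by (auto simp: D_def I_def S_def)
  then have "card D \<le> card (I \<union> S)"
    using fin by (intro card_mono) (auto simp: D_def I_def S_def)
  then have "card D \<le> card I + card S"
    using card_Un_le[of I S] by linarith
  ultimately have half: "card D \<le> 2 * card I"
    by linarith
  have pos: "card D > 0"
    using n v fin by (simp add: D_def)
  then have "I \<noteq> {}"
    using half by auto
  then have dom: "dominating_set T D"
    by (auto simp: dominating_set_def D_def I_def)
  have outside: "pverts T - D = {v}" and "D \<noteq> pverts T"
    using v by (auto simp: D_def)
  then have gap: "approval_gap T D = avg_inweight T v D"
    by (simp add: approval_gap_def)
  have "real k * real (card D) \<le> real k * (2 * real (card I))"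
    using half by (intro mult_left_mono) linarith+
  also have "real k * real (card I) \<le> (\<Sum>u\<in>I. real (weight T (u, v)))"
    using majority_tournament_weight_bounds(1)[OF T]
      sum_bounded_below[of I "real k" "\<lambda>u. real (weight T (u, v))"]
    by (simp add: I_def mult.commute)
  then have "real k * (2 * real (card I)) \<le> 2 * (\<Sum>u\<in>I. real (weight T (u, v)))"
    by simp
  finally have "real k / 2 \<le> avg_inweight T v D"
    using pos by (simp add: avg_inweight_def I_def[symmetric] field_simps)
  then show ?thesis
    using dom gap by auto
qed

lemma avg_inweight_le:
  assumes T: "weighted_majority_tournament k T" and "D \<subseteq> pverts T"
  shows "avg_inweight T v D \<le> 2 * real k - 1"
proof -
  have k: "k \<ge> 1" and fin: "finite D"
    using T assms(2) by (auto simp: weighted_majority_tournament_def intro: finite_subset)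
  let ?I = "{u \<in> D. (u, v) \<in> parcs T}"
  have "real (weight T (u, v)) \<le> 2 * real k - 1" if "u \<in> ?I" for u
    using majority_tournament_weight_bounds(2)[OF T, of u v] that k by auto
  then have "(\<Sum>u\<in>?I. real (weight T (u, v))) \<le> real (card ?I) * (2 * real k - 1)"
    by (intro sum_bounded_above)
  also have "\<dots> \<le> real (card D) * (2 * real k - 1)"
    using fin k by (intro mult_right_mono) (auto intro!: card_mono)
  finally show ?thesis
    using k by (cases "card D = 0") (auto simp: avg_inweight_def field_simps)
qed

lemma approval_gap_le:
  assumes T: "weighted_majority_tournament k T" and D: "D \<subseteq> pverts T"
  shows "approval_gap T D \<le> 2 * real k - 1"
proof (cases "D = pverts T")
  case True
  then show ?thesis
    using T by (simp add: approval_gap_def weighted_majority_tournament_def)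
next
  case False
  then obtain v where "v \<in> pverts T - D"
    using D by blast
  moreover have "finite (pverts T)"
    using T by (simp add: weighted_majority_tournament_def)
  ultimately have "approval_gap T D \<le> avg_inweight T v D"
    using False by (simp add: approval_gap_def)
  also have "\<dots> \<le> 2 * real k - 1"
    by (rule avg_inweight_le[OF T D])
  finally show ?thesis .
qed

theorem proposition2:
  fixes k :: nat and T :: "'a weighted_digraph"
  assumes "weighted_majority_tournament k T"
  shows "(card (pverts T) \<ge> 2 \<longrightarrow> real k / 2 \<le> max_approval_gap T)
       \<and> max_approval_gap T \<le> 2 * real k - 1"
proof -
  let ?G = "approval_gap T ` {D. dominating_set T D}"
  have "finite (pverts T)"
    using assms by (simp add: weighted_majority_tournament_def)
  moreover have "{D. dominating_set T D} \<subseteq> Pow (pverts T)"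
    by (auto simp: dominating_set_def)
  ultimately have fin: "finite ?G"
    by (meson finite_Pow_iff finite_imageI finite_subset)
  have "dominating_set T (pverts T)"
    by (simp add: dominating_set_def)
  then have "?G \<noteq> {}"
    by blast
  then have "max_approval_gap T \<le> 2 * real k - 1"
    using fin approval_gap_le[OF assms]
    by (auto simp: max_approval_gap_def dominating_set_def)
  moreover have "real k / 2 \<le> max_approval_gap T" if n: "card (pverts T) \<ge> 2"
  proof -
    obtain D where D: "dominating_set T D" "real k / 2 \<le> approval_gap T D"
      using exists_dominating_set_gap_ge_half[OF assms n] by blast
    have "approval_gap T D \<le> max_approval_gap T"
      using fin D(1) by (simp add: max_approval_gap_def)
    with D(2) show ?thesis by linarith
  qed
  ultimately show ?thesis by blast
qed

end
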